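(* For $n,m\in\mathbb{Z}_{\ge 0}$ let $a_{n,m}$ denote the number of sequences of integers $(x_0,x_1,\dots,x_n)$ with $x_0=0$, $x_n=m$, $x_i\ge 0$ for all $i$, and $|x_i-x_{i-1}|=1$ for $1\le i\le n$ (unit step paths of length $n$ on $\mathbb{Z}_{\ge0}$ from $0$ to $m$), and let $a_n=\sum_{m\ge 0}a_{n,m}$. Put $a_n^a=\sqrt{2/\pi}\cdot n^{-1/2}\cdot 2^n$. (a) $a_n\sim a_n^a$ as $n\to\infty$, and $|a_n-a_n^a|/(n^{-1/2}\cdot 2^n)\in O(1/n)$. (b) Fix $\ell\in\mathbb{Z}_{\ge 3}$ and for $r\in\{0,\dots,\ell-1\}$ set $c_n^{(r)}=\sum_{m\ge 0,\ m\equiv r \bmod \ell}a_{n,m}$. Then, as $n\to\infty$: if $\ell$ is odd, $c_n^{(r)}=\tfrac{1}{\ell}\,a_n\,(1+O(1/n))$; if $\ell$ is even and $r\not\equiv n \pmod 2$, $c_n^{(r)}=0$; if $\ell$ is even and $r\equiv n\pmod 2$, $c_n^{(r)}=\tfrac{2}{\ell}\,a_n\,(1+O(1/n))$.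
   Context: $\sim$ denotes asymptotic equality and $O$ is the usual big-O notation as $n\to\infty$. *)

theory Defs
  imports "HOL-Analysis.Analysis" "HOL-Library.Landau_Symbols"
begin

definition step_paths :: "nat \<Rightarrow> nat \<Rightarrow> int list set" where
  "step_paths n m = {xs. length xs = Suc n \<and> xs ! 0 = 0 \<and> xs ! n = int m \<and>
      (\<forall>i\<le>n. xs ! i \<ge> 0) \<and> (\<forall>i\<in>{1..n}. \<bar>xs ! i - xs ! (i - 1)\<bar> = 1)}"

definition a_nm :: "nat \<Rightarrow> nat \<Rightarrow> nat" where
  "a_nm n m = card (step_paths n m)"

text \<open>a_n = sum over m \<ge> 0 of a_{n,m}; written as an infinite sum (it is finitely supported).\<close>
definition a_n :: "nat \<Rightarrow> real" where
  "a_n n = (\<Sum>\<^sub>\<infinity>m\<in>(UNIV::nat set). real (a_nm n m))"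

definition a_approx :: "nat \<Rightarrow> real" where
  "a_approx n = sqrt (2 / pi) * real n powr (-1/2) * 2 ^ n"

definition c_n :: "nat \<Rightarrow> nat \<Rightarrow> nat \<Rightarrow> real" where
  "c_n l r n = (\<Sum>\<^sub>\<infinity>m\<in>{m::nat. m mod l = r}. real (a_nm n m))"

end

theory Submission
  imports Defs "HOL-Real_Asymp.Real_Asymp"
begin

text \<open>
  As in the reflection principle, \<open>a_nm n m\<close> is a difference of two consecutive entries of the
  \<open>n\<close>-th binomial row, so \<open>a_n n\<close> telescopes to the middle binomial coefficient; the monotone
  convergence of the Wallis product from both sides gives (a) with an explicit error.
  For (b), only the \<open>m\<close> with the parity of \<open>n\<close> contribute; list their values as
  \<open>G 0, G 1, \<dots>\<close>. A residue class of \<open>m\<close> modulo \<open>l\<close> becomes a residue class of the index modulo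
  \<open>k\<close>, where \<open>k = l\<close> for odd \<open>l\<close> and \<open>k = l / 2\<close> for even \<open>l\<close>.
  Differencing twice shows that the sums of \<open>G\<close> over the classes modulo \<open>k\<close> differ by at most a
  constant times \<open>G 0\<close> plus the \<open>\<ell>\<^sub>1\<close> norm of the second difference of \<open>G\<close>. The latter is at most
  the \<open>\<ell>\<^sub>1\<close> norm of the coefficients of \<open>(1 + X)\<^sup>n (1 - X)\<^sup>3\<close>. Split this polynomial into three
  factors \<open>(1 + X)\<^sup>m (1 - X)\<close> with \<open>m\<close> about \<open>n / 3\<close>: each has norm \<open>O(2\<^sup>m / \<surd>m)\<close> by
  Cauchy-Schwarz and the binomial variance, so the product is \<open>O(2\<^sup>n n\<^bsup>-3/2\<^esup>) = O(a_n n / n)\<close>.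
\<close>

subsection \<open>Counting paths\<close>

lemma step_paths_0: "step_paths 0 m = (if m = 0 then {[0]} else {})"
proof -
  have "xs = [0]" if "length xs = Suc 0" "xs ! 0 = 0" for xs :: "int list"
    using that by (cases xs) auto
  then show ?thesis by (auto simp: step_paths_def)
qed

text \<open>Dropping the last vertex leaves a path that ends at a neighbour of \<open>m\<close>;
  this neighbour is recovered from the list as \<open>nat (ys ! n)\<close>.\<close>

lemma step_paths_append:
  "ys @ [z] \<in> step_paths (Suc n) m \<longleftrightarrow>
     z = int m \<and> (\<exists>p. ys \<in> step_paths n p \<and> \<bar>int m - int p\<bar> = 1)"
proof
  assume L: "ys @ [z] \<in> step_paths (Suc n) m"
  then have len: "length ys = Suc n" and "(ys @ [z]) ! Suc n = int m"
    and nonneg: "\<And>i. i \<le> Suc n \<Longrightarrow> (ys @ [z]) ! i \<ge> 0"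
    and step: "\<And>i. 1 \<le> i \<Longrightarrow> i \<le> Suc n \<Longrightarrow> \<bar>(ys @ [z]) ! i - (ys @ [z]) ! (i - 1)\<bar> = 1"
    and start: "(ys @ [z]) ! 0 = 0"
    by (auto simp: step_paths_def)
  then have z: "z = int m" by (simp add: nth_append)
  have ge: "ys ! i \<ge> 0" if "i \<le> n" for i
    using nonneg[of i] that len by (simp add: nth_append)
  have st: "\<bar>ys ! i - ys ! (i - 1)\<bar> = 1" if "1 \<le> i" "i \<le> n" for i
  proof -
    have "i < Suc n" "i - 1 < Suc n" using that by auto
    then show ?thesis using step[of i] that len by (simp add: nth_append)
  qed
  have "ys \<in> step_paths n (nat (ys ! n))"
    using len start ge st by (auto simp: step_paths_def nth_append)
  moreover have "\<bar>int m - int (nat (ys ! n))\<bar> = 1"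
    using step[of "Suc n"] ge[of n] len z by (simp add: nth_append)
  ultimately show "z = int m \<and> (\<exists>p. ys \<in> step_paths n p \<and> \<bar>int m - int p\<bar> = 1)"
    using z by blast
next
  assume "z = int m \<and> (\<exists>p. ys \<in> step_paths n p \<and> \<bar>int m - int p\<bar> = 1)"
  then obtain p where z: "z = int m" and ys: "ys \<in> step_paths n p" and p: "\<bar>int m - int p\<bar> = 1"
    by blast
  have len: "length ys = Suc n" using ys by (simp add: step_paths_def)
  have "(ys @ [z]) ! i \<ge> 0" if "i \<le> Suc n" for i
    using ys that z by (cases "i = Suc n") (auto simp: step_paths_def nth_append)
  moreover have "\<bar>(ys @ [z]) ! i - (ys @ [z]) ! (i - 1)\<bar> = 1" if "1 \<le> i" "i \<le> Suc n" for i
  proof (cases "i = Suc n")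
    case True
    then show ?thesis using ys z p by (auto simp: step_paths_def nth_append)
  next
    case False
    then have "i < Suc n" "i - 1 < Suc n" using that by auto
    then show ?thesis using ys that by (auto simp: step_paths_def nth_append)
  qed
  ultimately show "ys @ [z] \<in> step_paths (Suc n) m"
    using ys z len by (auto simp: step_paths_def nth_append)
qed

text \<open>The neighbours of \<open>m\<close> in the nonnegative integers are \<open>Suc m\<close>
  and, for \<open>m \<noteq> 0\<close>, \<open>m - 1\<close>. The case split keeps truncated
  subtraction from counting 0 as its own neighbour.\<close>

lemma step_paths_Suc:
  "step_paths (Suc n) m =
     (\<lambda>ys. ys @ [int m]) ` (step_paths n (Suc m) \<union> (if m = 0 then {} else step_paths n (m - 1)))"
proof -
  have pred: "\<bar>int m - int p\<bar> = 1 \<longleftrightarrow> p = Suc m \<or> (m \<noteq> 0 \<and> p = m - 1)" for p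
    by (cases m) auto
  show ?thesis (is "?L = ?R")
  proof (intro set_eqI iffI)
    fix xs assume xs: "xs \<in> ?L"
    then have "xs \<noteq> []" by (auto simp: step_paths_def)
    then obtain ys z where "xs = ys @ [z]" by (metis append_butlast_last_id)
    with xs obtain p where "xs = ys @ [int m]" "ys \<in> step_paths n p" "\<bar>int m - int p\<bar> = 1"
      by (auto simp: step_paths_append)
    then show "xs \<in> ?R" unfolding pred by (auto split: if_splits)
  next
    fix xs assume "xs \<in> ?R"
    then obtain ys where xs: "xs = ys @ [int m]"
      and ys: "ys \<in> step_paths n (Suc m) \<union> (if m = 0 then {} else step_paths n (m - 1))"
      by blast
    have "\<exists>p. ys \<in> step_paths n p \<and> \<bar>int m - int p\<bar> = 1"
      unfolding pred using ys by (auto split: if_splits)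
    then show "xs \<in> ?L" unfolding xs step_paths_append by blast
  qed
qed

lemma finite_step_paths: "finite (step_paths n m)"
  by (induction n arbitrary: m) (auto simp: step_paths_0 step_paths_Suc)

lemma a_nm_0: "a_nm 0 m = (if m = 0 then 1 else 0)"
  by (simp add: a_nm_def step_paths_0)

text \<open>Appending a fixed vertex is injective, and the two sets of prefixes are disjoint because
  their last vertices differ.\<close>

lemma a_nm_Suc: "a_nm (Suc n) m = a_nm n (Suc m) + (if m = 0 then 0 else a_nm n (m - 1))"
proof -
  have "card (step_paths (Suc n) m) =
      card (step_paths n (Suc m) \<union> (if m = 0 then {} else step_paths n (m - 1)))"
    unfolding step_paths_Suc by (rule card_image) (simp add: inj_on_def)
  also have "\<dots> = card (step_paths n (Suc m)) + card (if m = 0 then {} else step_paths n (m - 1))"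
  proof (rule card_Un_disjoint)
    show "step_paths n (Suc m) \<inter> (if m = 0 then {} else step_paths n (m - 1)) = {}"
      by (auto simp: step_paths_def)
  qed (simp_all add: finite_step_paths)
  finally show ?thesis by (simp add: a_nm_def)
qed

text \<open>By Pascal's rule the right-hand side obeys the recursion \<open>a_nm_Suc\<close>; only
  the wall \<open>m = 0\<close> needs a separate argument.\<close>

lemma a_nm_eq:
  "real (a_nm n m) =
     (if even (n + m) then real (n choose ((n + m) div 2)) - real (n choose Suc ((n + m) div 2))
      else 0)"
proof (induction n arbitrary: m)
  case 0
  show ?case by (cases m) (auto simp: a_nm_0 elim!: evenE oddE)
next
  case (Suc n)
  show ?case
  proof (cases "even (Suc n + m)")
    case False
    then show ?thesis by (cases m) (auto simp: a_nm_Suc Suc)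
  next
    case True
    then obtain h where h: "Suc n + m = 2 * h" by (elim evenE)
    show ?thesis
    proof (cases m)
      case 0
      then obtain g where g: "h = Suc g" using h by (cases h) auto
      have n: "n = 2 * g + 1" using h g 0 by simp
      \<comment> \<open>At the wall the term for \<open>m - 1\<close> is absent. The closed form
        would give it the value \<open>(n choose g) - (n choose Suc g)\<close>, which vanishes by
        symmetry of the row.\<close>
      have "n choose g = n choose Suc g"
        using binomial_symmetric[of g n] n by simp
      moreover have "(n + 1) div 2 = Suc g" using n by simp
      ultimately show ?thesis using Suc[of 1] n 0 by (simp only: a_nm_Suc) simp
    next
      case (Suc p)
      then obtain g where g: "h = Suc g" using h by (cases h) auto
      have "n + p = 2 * g" using h g Suc by simp
      then show ?thesis using Suc by (simp add: a_nm_Suc Suc.IH)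
    qed
  qed
qed

subsection \<open>Equidistribution over residue classes\<close>

text \<open>Any two of the \<open>k\<close> values are joined by fewer than \<open>k\<close> steps
  of size at most \<open>B\<close>, and the deviation from the mean is the average of the deviations
  from the single values.\<close>

lemma abs_diff_mean_le:
  fixes U :: "nat \<Rightarrow> real"
  assumes "\<And>s. Suc s < k \<Longrightarrow> \<bar>U s - U (Suc s)\<bar> \<le> B" and "s < k" and "B \<ge> 0"
  shows "\<bar>U s - (\<Sum>t<k. U t) / real k\<bar> \<le> real k * B"
proof -
  have chain: "\<bar>U a - U (a + d)\<bar> \<le> real d * B" if "a + d < k" for a d
    using that
  proof (induction d)
    case (Suc d)
    then show ?case using assms(1)[of "a + d"] by (simp add: algebra_simps)
  qed simp
  have diff: "\<bar>U s - U t\<bar> \<le> real k * B" if "t < k" for t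
  proof (cases "s \<le> t")
    case True
    have "real (t - s) * B \<le> real k * B" using assms(3) that by (intro mult_right_mono) auto
    then show ?thesis using chain[of s "t - s"] True that by simp
  next
    case False
    have "real (s - t) * B \<le> real k * B" using assms(2,3) by (intro mult_right_mono) auto
    then show ?thesis using chain[of t "s - t"] False assms(2) by (simp add: abs_minus_commute)
  qed
  have k: "real k > 0" using assms(2) by simp
  have "real k * (U s - (\<Sum>t<k. U t) / real k) = (\<Sum>t<k. U s - U t)"
    using k by (simp add: sum_subtractf right_diff_distrib)
  then have "real k * \<bar>U s - (\<Sum>t<k. U t) / real k\<bar> = \<bar>\<Sum>t<k. U s - U t\<bar>"
    using k by (metis abs_mult abs_of_pos)
  also have "\<dots> \<le> (\<Sum>t<k. real k * B)"
    by (rule order_trans[OF sum_abs sum_mono]) (use diff in auto)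
  finally show ?thesis using k by simp
qed

text \<open>Division with remainder writes each \<open>j < k * N\<close> uniquely as
  \<open>s + k * i\<close>; the induction appends one block of length \<open>k\<close>.\<close>

lemma sum_residue_classes:
  fixes f :: "nat \<Rightarrow> 'a::comm_monoid_add"
  shows "(\<Sum>s<k. \<Sum>i<N. f (s + k * i)) = (\<Sum>j<k * N. f j)"
proof (induction N)
  case (Suc N)
  have "(\<Sum>j<a + k. f j) = (\<Sum>j<a. f j) + (\<Sum>s<k. f (a + s))" for a
    by (induction k) (simp_all add: add.assoc)
  from this[of "k * N"] show ?case using Suc by (simp add: sum.distrib add.commute)
qed simp

lemma sum_residue_class_le:
  fixes f :: "nat \<Rightarrow> real"
  assumes "\<And>j. f j \<ge> 0" and "s < k"
  shows "(\<Sum>i<N. f (s + k * i)) \<le> (\<Sum>j<k * N. f j)"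
  unfolding sum_residue_classes[symmetric]
  by (rule member_le_sum) (use assms in \<open>auto intro: sum_nonneg\<close>)

text \<open>The averaging lemma is applied twice to the class sums \<open>S\<close>. Their second
  differences are at most \<open>V\<close>, so the first differences are close to their mean, which
  telescopes to \<open>G 0 / k\<close>. Hence the first differences are small, and so
  \<open>S\<close> is close to its own mean.\<close>

lemma equidistribution_residue_classes:
  fixes G :: "nat \<Rightarrow> real"
  assumes G0: "\<And>j. j \<ge> N \<Longrightarrow> G j = 0" and s: "s < k"
    and V: "(\<Sum>j<k * N. \<bar>G j - 2 * G (Suc j) + G (Suc (Suc j))\<bar>) \<le> V"
  shows "\<bar>(\<Sum>i<N. G (s + k * i)) - (\<Sum>j<N. G j) / real k\<bar> \<le> real k * (\<bar>G 0\<bar> + real k * V)"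
proof -
  define S where "S s = (\<Sum>i<N. G (s + k * i))" for s
  have k: "k \<ge> 1" using s by simp
  have "V \<ge> 0" by (rule order_trans[OF _ V]) (simp add: sum_nonneg)
  have TT: "\<bar>(S s - S (Suc s)) - (S (Suc s) - S (Suc (Suc s)))\<bar> \<le> V" if "s < k" for s
  proof -
    have "(S s - S (Suc s)) - (S (Suc s) - S (Suc (Suc s))) =
        (\<Sum>i<N. G (s + k * i) - 2 * G (Suc (s + k * i)) + G (Suc (Suc (s + k * i))))"
      by (simp add: S_def sum.distrib sum_subtractf sum_distrib_left[symmetric])
    also have "\<bar>\<dots>\<bar> \<le> (\<Sum>i<N. \<bar>G (s + k * i) - 2 * G (Suc (s + k * i)) + G (Suc (Suc (s + k * i)))\<bar>)"
      by (rule sum_abs)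
    also have "\<dots> \<le> (\<Sum>j<k * N. \<bar>G j - 2 * G (Suc j) + G (Suc (Suc j))\<bar>)"
      by (rule sum_residue_class_le) (use that in auto)
    finally show ?thesis using V by linarith
  qed
  \<comment> \<open>\<open>S k\<close> runs over the class of 0 one period late, so it lacks
    \<open>G 0\<close>; the additional last term \<open>G (k * N)\<close> is 0 because
    \<open>k * N \<ge> N\<close>.\<close>
  have "S k + G 0 = (\<Sum>i<Suc N. G (k * i))"
    by (simp add: S_def sum.lessThan_Suc_shift del: sum.lessThan_Suc)
  also have "\<dots> = S 0"
    using G0[of "k * N"] k by (simp add: S_def)
  finally have "S 0 - S k = G 0" by simp
  moreover have "(\<Sum>t<k. S t - S (Suc t)) = S 0 - S k"
    by (rule sum_lessThan_telescope')
  ultimately have T: "\<bar>(S t - S (Suc t)) - G 0 / real k\<bar> \<le> real k * V" if "t < k" for t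
    using abs_diff_mean_le[of k "\<lambda>t. S t - S (Suc t)" V t] TT that \<open>V \<ge> 0\<close> by simp
  have "\<bar>G 0 / real k\<bar> \<le> \<bar>G 0\<bar>"
    using k by (simp add: abs_divide divide_le_eq mult_le_cancel_left1)
  then have "\<bar>S t - S (Suc t)\<bar> \<le> \<bar>G 0\<bar> + real k * V" if "t < k" for t
    using T[OF that] by linarith
  then have "\<bar>S s - (\<Sum>t<k. S t) / real k\<bar> \<le> real k * (\<bar>G 0\<bar> + real k * V)"
    using s \<open>V \<ge> 0\<close> by (intro abs_diff_mean_le) auto
  moreover have "(\<Sum>t<k. S t) = (\<Sum>j<N. G j)"
  proof -
    have "(\<Sum>t<k. S t) = (\<Sum>j<k * N. G j)" unfolding S_def by (rule sum_residue_classes)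
    also have "\<dots> = (\<Sum>j<N. G j)"
      by (rule sum.mono_neutral_right) (use k G0 in \<open>auto intro: less_le_trans\<close>)
    finally show ?thesis .
  qed
  ultimately show ?thesis unfolding S_def by simp
qed

subsection \<open>Third differences of binomial coefficients\<close>

text \<open>The coefficient norm is cut off at a free index \<open>N\<close>, so that no degrees
  have to be tracked.\<close>

definition l1_coeff :: "nat \<Rightarrow> real poly \<Rightarrow> real" where
  "l1_coeff N p = (\<Sum>i\<le>N. \<bar>coeff p i\<bar>)"

lemma l1_coeff_nonneg: "l1_coeff N p \<ge> 0"
  by (simp add: l1_coeff_def sum_nonneg)

text \<open>The pairs with \<open>i + j \<le> N\<close> form a triangle inside the square of all
  \<open>i, j \<le> N\<close>, so submultiplicativity survives the cut-off.\<close>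

lemma l1_coeff_mult: "l1_coeff N (p * q) \<le> l1_coeff N p * l1_coeff N q"
proof -
  have "l1_coeff N (p * q) \<le> (\<Sum>k\<le>N. \<Sum>i\<le>k. \<bar>coeff p i\<bar> * \<bar>coeff q (k - i)\<bar>)"
    unfolding l1_coeff_def coeff_mult abs_mult[symmetric] by (intro sum_mono sum_abs)
  also have "\<dots> = (\<Sum>(i, j)\<in>{(i, j). i + j \<le> N}. \<bar>coeff p i\<bar> * \<bar>coeff q j\<bar>)"
    by (rule sum.triangle_reindex_eq[symmetric])
  also have "\<dots> \<le> (\<Sum>(i, j)\<in>{..N} \<times> {..N}. \<bar>coeff p i\<bar> * \<bar>coeff q j\<bar>)"
    by (rule sum_mono2) auto
  also have "\<dots> = l1_coeff N p * l1_coeff N q"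
    by (simp add: l1_coeff_def sum_product sum.cartesian_product)
  finally show ?thesis .
qed

text \<open>A sum of \<open>M\<close> independent random signs has variance \<open>M\<close>; the
  factor \<open>2 ^ M\<close> removes the normalisation. The moments are those of the Bernstein
  polynomials at 1/2.\<close>

lemma sum_binomial_deviation_squared:
  "(\<Sum>k\<le>M. (real M - 2 * real k)\<^sup>2 * real (M choose k)) = real M * 2 ^ M"
proof -
  have B: "real (M choose k) = 2 ^ M * Bernstein M k (1/2)" if "k \<le> M" for k
  proof -
    have "(1/2::real) ^ k * (1/2) ^ (M - k) = (1/2) ^ M"
      using that by (simp flip: power_add)
    then show ?thesis by (simp add: Bernstein_def mult.assoc power_one_over)
  qed
  \<comment> \<open>The square is expanded in the falling factorials \<open>1\<close>,
    \<open>k\<close>, \<open>k * (k - 1)\<close>, whose Bernstein sums are known.\<close>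
  have "(\<Sum>k\<le>M. (real M - 2 * real k)\<^sup>2 * real (M choose k)) =
      (\<Sum>k\<le>M. 2 ^ M * ((real M)\<^sup>2 * Bernstein M k (1/2)
        + (4 - 4 * real M) * (real k * Bernstein M k (1/2))
        + 4 * (real k * (real k - 1) * Bernstein M k (1/2))))"
    by (intro sum.cong refl) (simp add: B power2_eq_square algebra_simps)
  also have "\<dots> = 2 ^ M * ((real M)\<^sup>2 * (\<Sum>k\<le>M. Bernstein M k (1/2))
        + (4 - 4 * real M) * (\<Sum>k\<le>M. real k * Bernstein M k (1/2))
        + 4 * (\<Sum>k\<le>M. real k * (real k - 1) * Bernstein M k (1/2)))"
    by (simp only: sum.distrib sum_distrib_left[symmetric])
  also have "\<dots> = real M * 2 ^ M"
    unfolding sum_Bernstein sum_k_Bernstein sum_kk_Bernstein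
    by (simp add: power2_eq_square algebra_simps)
  finally show ?thesis .
qed

lemma coeff_one_plus_X_power: "coeff ([:1, 1:] ^ n) i = real (n choose i)"
proof (cases "i \<le> n")
  case True
  then show ?thesis by (simp add: coeff_linear_poly_power)
next
  case False
  then show ?thesis by (simp add: coeff_eq_0 degree_linear_power)
qed

text \<open>With \<open>M = Suc m\<close>, the \<open>k\<close>-th coefficient is
  \<open>(M - 2 * k) / M * (M choose k)\<close>. The norm is thus bounded by a mean absolute
  deviation, which Cauchy-Schwarz compares with the standard deviation.\<close>

lemma l1_coeff_binomial_difference:
  "l1_coeff N ([:1, 1:] ^ m * [:1, -1:]) \<le> 2 ^ Suc m / sqrt (real (Suc m))"
proof -
  let ?M = "Suc m"
  let ?f = "\<lambda>k. \<bar>real ?M - 2 * real k\<bar> * real (?M choose k)"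
  have coeff: "real ?M * \<bar>coeff ([:1, 1:] ^ m * [:1, -1:]) k\<bar> = ?f k" for k
  proof -
    have "real ?M * coeff ([:1, 1:] ^ m * [:1, -1:]) k = (real ?M - 2 * real k) * real (?M choose k)"
    proof (cases k)
      case 0
      then show ?thesis by (simp add: coeff_mult coeff_one_plus_X_power)
    next
      case (Suc i)
      have "coeff ([:1, 1:] ^ m * [:1, -1:]) k = real (m choose k) - real (m choose i)"
        unfolding Suc by (simp add: coeff_one_plus_X_power)
      moreover have "real ?M * real (m choose i) = real k * real (?M choose k)"
        unfolding Suc of_nat_mult[symmetric] by (metis Suc_times_binomial)
      moreover have "real (?M choose k) = real (m choose k) + real (m choose i)"
        by (simp add: Suc)
      ultimately show ?thesis by (simp only: right_diff_distrib left_diff_distrib distrib_left)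
    qed
    then show ?thesis by (metis abs_mult abs_of_nat)
  qed
  have "(\<Sum>k\<le>N. ?f k) \<le> (\<Sum>k\<le>max N ?M. ?f k)"
    by (rule sum_mono2) auto
  also have "\<dots> = (\<Sum>k\<le>?M. ?f k)"
    by (rule sum.mono_neutral_right) (auto simp: not_le binomial_eq_0)
  finally have le: "real ?M * l1_coeff N ([:1, 1:] ^ m * [:1, -1:]) \<le> (\<Sum>k\<le>?M. ?f k)"
    by (simp only: l1_coeff_def sum_distrib_left coeff)
  \<comment> \<open>Each binomial weight is split into two square roots, one for each factor of
    Cauchy-Schwarz.\<close>
  have "(\<Sum>k\<le>?M. ?f k)\<^sup>2 =
      (\<Sum>k\<le>?M. (\<bar>real ?M - 2 * real k\<bar> * sqrt (real (?M choose k))) * sqrt (real (?M choose k)))\<^sup>2"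
    by (simp only: mult.assoc real_sqrt_mult_self abs_of_nat)
  also have "\<dots> \<le> (\<Sum>k\<le>?M. (\<bar>real ?M - 2 * real k\<bar> * sqrt (real (?M choose k)))\<^sup>2)
      * (\<Sum>k\<le>?M. (sqrt (real (?M choose k)))\<^sup>2)"
    by (rule Cauchy_Schwarz_ineq_sum)
  also have "\<dots> = (\<Sum>k\<le>?M. (real ?M - 2 * real k)\<^sup>2 * real (?M choose k))
      * (\<Sum>k\<le>?M. real (?M choose k))"
    by (simp only: power_mult_distrib power2_abs real_sqrt_pow2 of_nat_0_le_iff)
  also have "(\<Sum>k\<le>?M. real (?M choose k)) = 2 ^ ?M"
    by (simp only: of_nat_sum[symmetric] choose_row_sum of_nat_power of_nat_numeral)
  also have "(\<Sum>k\<le>?M. (real ?M - 2 * real k)\<^sup>2 * real (?M choose k)) * 2 ^ ?M = (2 ^ ?M * sqrt (real ?M))\<^sup>2"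
    unfolding sum_binomial_deviation_squared
    by (simp only: power_mult_distrib real_sqrt_pow2 of_nat_0_le_iff power2_eq_square[of "2 ^ ?M"] mult_ac)
  finally have "(\<Sum>k\<le>?M. ?f k) \<le> 2 ^ ?M * sqrt (real ?M)"
    by (rule power2_le_imp_le) simp
  with le have "real ?M * l1_coeff N ([:1, 1:] ^ m * [:1, -1:]) \<le> 2 ^ ?M * sqrt (real ?M)"
    by linarith
  also have "2 ^ ?M * sqrt (real ?M) = real ?M * (2 ^ ?M / sqrt (real ?M))"
    by (simp add: real_div_sqrt field_simps del: of_nat_Suc power_Suc)
  finally show ?thesis
    by (simp only: mult_le_cancel_left_pos of_nat_0_less_iff zero_less_Suc)
qed

text \<open>Multiplication by 1 - X takes a backward difference of the coefficients. Starting at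
  index 3 avoids the boundary cases.\<close>

lemma coeff_binomial_third_difference:
  "coeff ([:1, 1:] ^ n * [:1, -1:] ^ 3) (Suc (Suc (Suc i))) =
     real (n choose Suc (Suc (Suc i))) - 3 * real (n choose Suc (Suc i))
       + 3 * real (n choose Suc i) - real (n choose i)"
proof -
  have cube: "[:1, -1:] ^ 3 = ([:1, -3, 3, -1:] :: real poly)"
    by (simp add: power3_eq_cube)
  show ?thesis unfolding cube by (simp add: coeff_one_plus_X_power)
qed

lemma sum_binomial_third_difference_le:
  "(\<Sum>i<N. \<bar>real (n choose Suc (Suc (Suc i))) - 3 * real (n choose Suc (Suc i))
       + 3 * real (n choose Suc i) - real (n choose i)\<bar>)
     \<le> 48 * 2 ^ n / (real (Suc n) * sqrt (real (Suc n)))"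
proof -
  let ?q = "\<lambda>m. [:1, 1:] ^ m * [:1, -1:] :: real poly"
  \<comment> \<open>The third factor takes the remainder of the division, so both exponents
    \<open>p\<close> satisfy \<open>Suc p \<ge> Suc n / 3\<close>. This is the source of
    \<open>sqrt 3\<close> in the bound of each factor.\<close>
  define m where "m = n div 3"
  define m' where "m' = n - 2 * m"
  have n: "n = m + m + m'" unfolding m_def m'_def by simp
  have bound: "l1_coeff K (?q p) \<le> 2 ^ p * 2 * sqrt 3 / sqrt (real (Suc n))"
    if "Suc n \<le> 3 * Suc p" for p K
  proof -
    have "sqrt (real (Suc n)) \<le> sqrt (3 * real (Suc p))" using that by simp
    also have "\<dots> = sqrt 3 * sqrt (real (Suc p))" by (rule real_sqrt_mult)
    finally have "2 ^ Suc p / sqrt (real (Suc p)) \<le> 2 ^ p * 2 * sqrt 3 / sqrt (real (Suc n))"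
      by (simp add: field_simps)
    then show ?thesis using l1_coeff_binomial_difference[of K p] by linarith
  qed
  have m: "Suc n \<le> 3 * Suc m" "Suc n \<le> 3 * Suc m'" unfolding m'_def m_def by presburger+
  let ?b = "\<lambda>p. 2 ^ p * 2 * sqrt 3 / sqrt (real (Suc n))"
  let ?p = "[:1, 1:] ^ n * [:1, -1:] ^ 3 :: real poly"
  have "(\<Sum>i<N. \<bar>real (n choose Suc (Suc (Suc i))) - 3 * real (n choose Suc (Suc i))
       + 3 * real (n choose Suc i) - real (n choose i)\<bar>) = (\<Sum>i<N. \<bar>coeff ?p (i + 3)\<bar>)"
    by (intro sum.cong refl arg_cong[where f = abs])
       (simp only: coeff_binomial_third_difference[symmetric] numeral_3_eq_3 add_Suc_right add_0_right)
  also have "\<dots> = (\<Sum>i\<in>(\<lambda>i. i + 3) ` {..<N}. \<bar>coeff ?p i\<bar>)"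
    by (subst sum.reindex) (auto simp: inj_on_def)
  also have "\<dots> \<le> l1_coeff (N + 3) ?p"
    unfolding l1_coeff_def by (rule sum_mono2) auto
  also have "?p = ?q m * ?q m * ?q m'"
    unfolding n power_add power3_eq_cube by (simp only: mult_ac)
  also have "l1_coeff (N + 3) (?q m * ?q m * ?q m') \<le>
      l1_coeff (N + 3) (?q m) * l1_coeff (N + 3) (?q m) * l1_coeff (N + 3) (?q m')"
    by (rule order_trans[OF l1_coeff_mult mult_right_mono[OF l1_coeff_mult l1_coeff_nonneg]])
  also have "\<dots> \<le> ?b m * ?b m * ?b m'"
    by (intro mult_mono bound m mult_nonneg_nonneg l1_coeff_nonneg) auto
  also have "\<dots> = 8 * (sqrt 3 * 3) * 2 ^ n / (real (Suc n) * sqrt (real (Suc n)))"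
    unfolding n power_add by (simp add: field_simps)
  \<comment> \<open>The three constants \<open>2 * sqrt 3\<close> multiply to
    \<open>24 * sqrt 3\<close>, and \<open>sqrt 3 \<le> 2\<close>.\<close>
  also have "\<dots> \<le> 48 * 2 ^ n / (real (Suc n) * sqrt (real (Suc n)))"
  proof -
    have "sqrt 3 \<le> sqrt (2\<^sup>2)" by (simp only: real_sqrt_le_iff) simp
    then have "sqrt 3 \<le> 2" by simp
    then show ?thesis by (intro divide_right_mono mult_right_mono) auto
  qed
  finally show ?thesis .
qed

subsection \<open>The middle binomial coefficient\<close>

definition wallis_prod :: "nat \<Rightarrow> real" where
  "wallis_prod n = (\<Prod>k=1..n. (4 * real k^2) / (4 * real k^2 - 1))"

lemma wallis_prod_0: "wallis_prod 0 = 1"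
  and wallis_prod_Suc: "wallis_prod (Suc n) =
    wallis_prod n * ((4 * real (Suc n)^2) / (4 * real (Suc n)^2 - 1))"
  by (simp_all add: wallis_prod_def)

text \<open>From \<open>m\<close> to \<open>m + 1\<close> the normalised binomial gains the factor
  \<open>(2 * m + 1) / (2 * m + 2)\<close>. Its square, times
  \<open>(2 * m + 3) / (2 * m + 1)\<close>, is the reciprocal of the new Wallis factor.\<close>

lemma central_binomial_wallis:
  "wallis_prod m * (real (2 * m choose m) / 4 ^ m)\<^sup>2 * (2 * real m + 1) = 1"
proof (induction m)
  case 0
  show ?case by (simp add: wallis_prod_0)
next
  case (Suc m)
  define c where "c = real (2 * m choose m) / 4 ^ m"
  define b where "b = 2 * Suc m choose Suc m"
  define x where "x = Suc (2 * m) choose m"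
  \<comment> \<open>The absorption identity is used twice, passing through the two equal middle
    entries of row \<open>2 * m + 1\<close>.\<close>
  have "Suc m * b = Suc (Suc (2 * m)) * x"
    unfolding b_def x_def mult_2 add_Suc add_Suc_right by (rule Suc_times_binomial)
  also have "\<dots> = 2 * (Suc m * x)" by simp
  also have "x = Suc (2 * m) choose Suc m"
    unfolding x_def using binomial_symmetric[of m "Suc (2 * m)"] by simp
  also have "Suc m * \<dots> = (2 * m + 1) * (2 * m choose m)"
    unfolding Suc_eq_plus1[of "2 * m", symmetric] by (rule Suc_times_binomial)
  finally have "real (Suc m * b) = real (2 * ((2 * m + 1) * (2 * m choose m)))"
    by (rule arg_cong)
  then have "real (Suc m) * real b = 2 * ((2 * real m + 1) * real (2 * m choose m))"
    by (simp only: of_nat_mult of_nat_add of_nat_numeral of_nat_1)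
  then have c: "real (2 * Suc m choose Suc m) / 4 ^ Suc m = c * (2 * real m + 1) / (2 * real (Suc m))"
    unfolding b_def[symmetric] by (simp add: c_def field_simps del: of_nat_Suc)
  have d: "4 * real (Suc m)^2 - 1 = (2 * real m + 1) * (2 * real m + 3)"
    by (simp add: power2_eq_square algebra_simps)
  have pos: "2 * real m + 1 \<noteq> 0" "2 * real m + 3 \<noteq> 0" "real (Suc m) \<noteq> 0"
    by (simp_all add: add_nonneg_eq_0_iff)
  have "wallis_prod (Suc m) * (real (2 * Suc m choose Suc m) / 4 ^ Suc m)\<^sup>2 * (2 * real (Suc m) + 1)
     = wallis_prod m * ((4 * real (Suc m)^2) / ((2 * real m + 1) * (2 * real m + 3)))
         * (c * (2 * real m + 1) / (2 * real (Suc m)))\<^sup>2 * (2 * real m + 3)"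
  proof -
    have "2 * real (Suc m) + 1 = 2 * real m + 3" by simp
    then show ?thesis by (simp only: wallis_prod_Suc c d)
  qed
  also have "\<dots> = wallis_prod m * c\<^sup>2 * (2 * real m + 1)"
  proof -
    have "w * ((4 * y\<^sup>2) / (a * b)) * (c * a / (2 * y))\<^sup>2 * b = w * c\<^sup>2 * a"
      if "a \<noteq> 0" "b \<noteq> 0" "y \<noteq> 0" for w y a b :: real
      using that by (simp add: power2_eq_square)
    then show ?thesis using pos by blast
  qed
  finally show ?case using Suc by (simp add: c_def)
qed

text \<open>All Wallis factors exceed 1, so the products increase to \<open>pi / 2\<close>;
  multiplied by \<open>(2 * m + 1) / (2 * m)\<close> they decrease to the same limit.\<close>

lemma wallis_prod_bounds:
  shows wallis_prod_pos: "wallis_prod m > 0"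
    and wallis_prod_le: "wallis_prod m \<le> pi / 2"
    and wallis_prod_ge: "m > 0 \<Longrightarrow> pi / 2 \<le> wallis_prod m * ((2 * real m + 1) / (2 * real m))"
proof -
  have lim: "wallis_prod \<longlonglongrightarrow> pi / 2"
    unfolding wallis_prod_def by (rule wallis)
  have d: "4 * real (Suc n)^2 - 1 = (2 * real n + 1) * (2 * real n + 3)" for n
    by (simp add: power2_eq_square algebra_simps)
  show pos: "wallis_prod m > 0" for m
    by (induction m) (simp_all add: wallis_prod_0 wallis_prod_Suc d del: of_nat_Suc)
  have "incseq wallis_prod"
  proof (rule incseq_SucI)
    fix n
    have "1 \<le> (4 * real (Suc n)^2) / (4 * real (Suc n)^2 - 1)"
      using d[of n] by (simp add: le_divide_eq del: of_nat_Suc)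
    then show "wallis_prod n \<le> wallis_prod (Suc n)"
      using mult_left_mono[of 1 _ "wallis_prod n"] pos[of n]
      by (simp only: wallis_prod_Suc mult_1_right less_imp_le)
  qed
  then show "wallis_prod m \<le> pi / 2" using lim by (rule incseq_le)
  \<comment> \<open>The index is shifted by one to avoid division by zero at 0.\<close>
  let ?v = "\<lambda>n. wallis_prod (Suc n) * ((2 * real (Suc n) + 1) / (2 * real (Suc n)))"
  have "decseq ?v"
  proof (rule decseq_SucI)
    fix n
    let ?k = "real (Suc (Suc n))"
    have "?v (Suc n) = wallis_prod (Suc n) * ((4 * ?k^2) / (4 * ?k^2 - 1) * ((2 * ?k + 1) / (2 * ?k)))"
      by (simp only: wallis_prod_Suc[of "Suc n"] mult.assoc)
    also have "(4 * ?k^2) / (4 * ?k^2 - 1) * ((2 * ?k + 1) / (2 * ?k)) = 2 * ?k / (2 * ?k - 1)"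
    proof -
      have "(4 * y\<^sup>2) / (a * b) * (b / (2 * y)) = 2 * y / a"
        if "a \<noteq> 0" "b \<noteq> 0" "y \<noteq> 0" for y a b :: real
        using that by (simp add: power2_eq_square)
      moreover have "4 * ?k^2 - 1 = (2 * ?k - 1) * (2 * ?k + 1)"
        by (simp add: power2_eq_square algebra_simps)
      moreover have "2 * ?k - 1 \<noteq> 0" "2 * ?k + 1 \<noteq> 0" "?k \<noteq> 0" by auto
      ultimately show ?thesis by metis
    qed
    also have "\<dots> \<le> (2 * real (Suc n) + 1) / (2 * real (Suc n))"
      by (simp add: field_simps)
    finally show "?v (Suc n) \<le> ?v n"
      using pos[of "Suc n"] by (simp del: of_nat_Suc)
  qed
  moreover have "?v \<longlonglongrightarrow> pi / 2 * 1"
  proof (intro tendsto_mult LIMSEQ_Suc[OF lim])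
    show "(\<lambda>n. (2 * real (Suc n) + 1) / (2 * real (Suc n))) \<longlonglongrightarrow> 1"
      by real_asymp
  qed
  ultimately have "pi / 2 * 1 \<le> ?v n" for n by (rule decseq_ge)
  from this[of "m - 1"] show "pi / 2 \<le> wallis_prod m * ((2 * real m + 1) / (2 * real m))" if "m > 0"
    using that by simp
qed

text \<open>The Wallis identity is solved for the square of the normalised binomial; the upper bound
  on the product yields the lower bound here, and conversely.\<close>

lemma central_binomial_bounds:
  shows central_binomial_ge: "sqrt (2 / (pi * (2 * real m + 1))) \<le> real (2 * m choose m) / 4 ^ m"
    and central_binomial_le: "m > 0 \<Longrightarrow> real (2 * m choose m) / 4 ^ m \<le> sqrt (2 / (pi * (2 * real m)))"
proof -
  let ?u = "real (2 * m choose m) / 4 ^ m"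
  have W: "?u\<^sup>2 = 1 / (wallis_prod m * (2 * real m + 1))"
    using central_binomial_wallis[of m] wallis_prod_pos[of m]
    by (simp add: eq_divide_eq mult_ac add_nonneg_eq_0_iff)
  have "wallis_prod m * (2 * real m + 1) \<le> pi / 2 * (2 * real m + 1)"
    by (intro mult_right_mono wallis_prod_le) simp
  then have "1 / (pi / 2 * (2 * real m + 1)) \<le> ?u\<^sup>2"
    unfolding W using wallis_prod_pos[of m] by (intro divide_left_mono mult_pos_pos) auto
  then show "sqrt (2 / (pi * (2 * real m + 1))) \<le> ?u"
    by (intro real_le_lsqrt) auto
  assume m: "m > 0"
  have "pi / 2 * (2 * real m) \<le> wallis_prod m * (2 * real m + 1)"
    using wallis_prod_ge[OF m] m by (simp add: field_simps)
  then have "?u\<^sup>2 \<le> 1 / (pi / 2 * (2 * real m))"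
    unfolding W using wallis_prod_pos[of m] m by (intro divide_left_mono mult_pos_pos) auto
  then show "?u \<le> sqrt (2 / (pi * (2 * real m)))"
    by (intro real_le_rsqrt) auto
qed

text \<open>An even row is itself central, with \<open>n + 1\<close> and \<open>n\<close> under the
  roots. For odd \<open>n\<close> the entry is half the central one of row \<open>n + 1\<close>,
  which gives \<open>n + 2\<close> and \<open>n + 1\<close>. The weaker bound of each kind covers
  both parities.\<close>

lemma middle_binomial_bounds:
  assumes "n > 0"
  shows middle_binomial_ge: "2 ^ n * sqrt (2 / (pi * (real n + 2))) \<le> real (n choose (Suc n div 2))"
    and middle_binomial_le: "real (n choose (Suc n div 2)) \<le> 2 ^ n * sqrt (2 / (pi * real n))"
proof -
  have mono: "sqrt (2 / (pi * x)) \<le> sqrt (2 / (pi * y))" if "0 < y" "y \<le> x" for x y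
    using that by (intro real_sqrt_le_mono divide_left_mono mult_left_mono mult_pos_pos) auto
  have "2 ^ n * sqrt (2 / (pi * (real n + 2))) \<le> real (n choose (Suc n div 2)) \<and>
        real (n choose (Suc n div 2)) \<le> 2 ^ n * sqrt (2 / (pi * real n))"
  proof (cases "even n")
    case True
    then obtain m where n: "n = 2 * m" by (elim evenE)
    have four: "(4::real) ^ m = 2 ^ n" by (simp add: n power_mult)
    have "sqrt (2 / (pi * (real n + 2))) \<le> sqrt (2 / (pi * (real n + 1)))"
      by (rule mono) auto
    also have "\<dots> \<le> real (n choose m) / 2 ^ n"
      using central_binomial_ge[of m] unfolding four by (simp add: n)
    finally have "sqrt (2 / (pi * (real n + 2))) \<le> real (n choose m) / 2 ^ n" .
    moreover have "real (n choose m) / 2 ^ n \<le> sqrt (2 / (pi * real n))"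
      using central_binomial_le[of m] assms unfolding four by (simp add: n)
    moreover have "Suc n div 2 = m" by (simp add: n)
    ultimately show ?thesis by (simp only: le_divide_eq divide_le_eq) (simp add: mult.commute)
  next
    case False
    then obtain m where n: "n = 2 * m + 1" by (elim oddE)
    have four: "(4::real) ^ Suc m = 2 * 2 ^ n" by (simp add: n power_mult)
    have "n choose m = n choose Suc m"
      using binomial_symmetric[of m n] n by simp
    then have "2 * Suc m choose Suc m = 2 * (n choose Suc m)" by (simp add: n)
    then have half: "real (2 * Suc m choose Suc m) / 4 ^ Suc m = real (n choose Suc m) / 2 ^ n"
      unfolding four by simp
    have ge: "sqrt (2 / (pi * (real n + 2))) \<le> real (n choose Suc m) / 2 ^ n"
      using central_binomial_ge[of "Suc m"] unfolding half by (simp add: n algebra_simps)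
    have "real (n choose Suc m) / 2 ^ n \<le> sqrt (2 / (pi * (real n + 1)))"
      using central_binomial_le[of "Suc m"] unfolding half by (simp add: n algebra_simps)
    also have "\<dots> \<le> sqrt (2 / (pi * real n))"
      by (rule mono) (use assms in auto)
    finally have "real (n choose Suc m) / 2 ^ n \<le> sqrt (2 / (pi * real n))" .
    moreover have "Suc n div 2 = Suc m" by (simp add: n)
    ultimately have "sqrt (2 / (pi * (real n + 2))) \<le> real (n choose (Suc n div 2)) / 2 ^ n"
      "real (n choose (Suc n div 2)) / 2 ^ n \<le> sqrt (2 / (pi * real n))" using ge by simp_all
    then show ?thesis by (simp add: le_divide_eq divide_le_eq mult.commute)
  qed
  then show "2 ^ n * sqrt (2 / (pi * (real n + 2))) \<le> real (n choose (Suc n div 2))"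
    "real (n choose (Suc n div 2)) \<le> 2 ^ n * sqrt (2 / (pi * real n))" by auto
qed

subsection \<open>Asymptotics\<close>

lemma a_nm_eq_0:
  assumes "odd (n + m) \<or> n < m"
  shows "a_nm n m = 0"
proof -
  have "n < (n + m) div 2" if "even (n + m)" "n < m"
    using that by presburger
  then have "real (a_nm n m) = 0"
    using assms unfolding a_nm_eq by (auto simp: binomial_eq_0)
  then show ?thesis by simp
qed

text \<open>This is the sequence \<open>G\<close> of the overview: \<open>n mod 2 + 2 * j\<close>
  enumerates the endpoints with the parity of \<open>n\<close>.\<close>

definition half_ballot :: "nat \<Rightarrow> nat \<Rightarrow> real" where
  "half_ballot n j = real (a_nm n (n mod 2 + 2 * j))"

lemma half_ballot_eq:
  "half_ballot n j = real (n choose (Suc n div 2 + j)) - real (n choose Suc (Suc n div 2 + j))"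
proof -
  have "even (n + (n mod 2 + 2 * j))" "(n + (n mod 2 + 2 * j)) div 2 = Suc n div 2 + j"
    by presburger+
  then show ?thesis unfolding half_ballot_def a_nm_eq by simp
qed

lemma half_ballot_eq_0: "n < j \<Longrightarrow> half_ballot n j = 0"
  by (simp add: half_ballot_def a_nm_eq_0)

text \<open>A reachable endpoint \<open>m\<close> satisfies \<open>m \<le> n\<close> and has index
  \<open>m div 2\<close>, so \<open>j < Suc n\<close> covers the support.\<close>

lemma infsum_a_nm:
  "(\<Sum>\<^sub>\<infinity>m\<in>{m. P m}. real (a_nm n m)) =
     (\<Sum>j<Suc n. if P (n mod 2 + 2 * j) then half_ballot n j else 0)"
proof -
  let ?g = "\<lambda>j. n mod 2 + 2 * j"
  let ?J = "{j\<in>{..<Suc n}. P (?g j)}"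
  have "m \<in> ?g ` ?J" if "P m" "a_nm n m \<noteq> 0" for m
  proof -
    have "even (n + m)" "m \<le> n" using a_nm_eq_0[of n m] that(2) by (metis not_le)+
    then have "m = ?g (m div 2)" "m div 2 < Suc n" by presburger+
    then show ?thesis using that(1) by (intro image_eqI[of _ _ "m div 2"]) auto
  qed
  then have "(\<Sum>\<^sub>\<infinity>m\<in>{m. P m}. real (a_nm n m)) = (\<Sum>\<^sub>\<infinity>m\<in>?g ` ?J. real (a_nm n m))"
    by (intro infsum_cong_neutral) auto
  also have "\<dots> = (\<Sum>m\<in>?g ` ?J. real (a_nm n m))"
    by (rule infsum_finite) simp
  also have "\<dots> = (\<Sum>j\<in>?J. half_ballot n j)"
    by (subst sum.reindex) (auto simp: inj_on_def half_ballot_def)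
  also have "\<dots> = (\<Sum>j<Suc n. if P (?g j) then half_ballot n j else 0)"
    by (rule sum.inter_filter) simp
  finally show ?thesis .
qed

lemma a_n_eq_sum: "a_n n = (\<Sum>j<Suc n. half_ballot n j)"
  using infsum_a_nm[of n "\<lambda>_. True"] by (simp add: a_n_def)

lemma a_n_eq: "a_n n = real (n choose (Suc n div 2))"
proof -
  have "a_n n = (\<Sum>j<Suc n. real (n choose (Suc n div 2 + j)) - real (n choose (Suc n div 2 + Suc j)))"
    unfolding a_n_eq_sum half_ballot_eq by simp
  also have "\<dots> = real (n choose (Suc n div 2)) - real (n choose (Suc n div 2 + Suc n))"
    by (subst sum_lessThan_telescope') simp
  finally show ?thesis by (simp add: binomial_eq_0)
qed

lemma a_n_pos: "a_n n > 0"
proof -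
  have "Suc n div 2 \<le> n" by presburger
  then show ?thesis by (simp add: a_n_eq zero_less_binomial)
qed

section \<open>Comparison of \<open>a_n\<close> with \<open>a_approx\<close>\<close>

lemma a_approx_eq: "n > 0 \<Longrightarrow> a_approx n = 2 ^ n * sqrt (2 / (pi * real n))"
  by (simp add: a_approx_def powr_minus powr_half_sqrt real_sqrt_divide real_sqrt_mult field_simps)

lemma a_n_le: "n > 0 \<Longrightarrow> a_n n \<le> a_approx n"
  by (simp add: a_n_eq a_approx_eq middle_binomial_le)

lemma a_n_ge:
  assumes "n > 0"
  shows "(1 - 2 / real n) * a_approx n \<le> a_n n"
proof -
  \<comment> \<open>The root is the ratio of the lower bound for the middle binomial to
    \<open>a_approx n\<close>; on [0, 1] a square root is at least its argument.\<close>
  have le: "1 - 2 / real n \<le> sqrt (real n / (real n + 2))"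
  proof -
    have "1 - 2 / real n \<le> real n / (real n + 2)"
      using assms by (simp add: field_simps)
    also have "\<dots> \<le> sqrt (real n / (real n + 2))"
    proof (rule real_le_rsqrt)
      have "real n / (real n + 2) \<le> 1" by simp
      then show "(real n / (real n + 2))\<^sup>2 \<le> real n / (real n + 2)"
        unfolding power2_eq_square by (rule mult_left_le) simp
    qed
    finally show ?thesis .
  qed
  have "(1 - 2 / real n) * a_approx n \<le> sqrt (real n / (real n + 2)) * a_approx n"
    by (rule mult_right_mono[OF le]) (simp add: a_approx_def)
  also have "\<dots> = 2 ^ n * (sqrt (real n / (real n + 2)) * sqrt (2 / (pi * real n)))"
    using assms by (simp add: a_approx_eq)
  also have "sqrt (real n / (real n + 2)) * sqrt (2 / (pi * real n)) = sqrt (2 / (pi * (real n + 2)))"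
    unfolding real_sqrt_mult[symmetric] using assms by simp
  also have "2 ^ n * \<dots> \<le> a_n n"
    using assms by (simp add: a_n_eq middle_binomial_ge)
  finally show ?thesis .
qed

lemma a_n_asymp_equiv: "a_n \<sim>[at_top] a_approx"
proof (rule asymp_equivI')
  have pos: "a_approx n > 0" if "n > 0" for n
    using that by (simp add: a_approx_def)
  show "(\<lambda>n. a_n n / a_approx n) \<longlonglongrightarrow> 1"
  proof (rule tendsto_sandwich)
    show "\<forall>\<^sub>F n in sequentially. 1 - 2 / real n \<le> a_n n / a_approx n"
      using eventually_gt_at_top[of 0]
      by eventually_elim (simp only: le_divide_eq pos a_n_ge if_True)
    show "\<forall>\<^sub>F n in sequentially. a_n n / a_approx n \<le> 1"
      using eventually_gt_at_top[of 0]
      by eventually_elim (simp only: divide_le_eq pos a_n_le if_True mult_1)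
    show "(\<lambda>n. 1 - 2 / real n) \<longlonglongrightarrow> 1" by real_asymp
  qed simp
qed

lemma a_n_error:
  "(\<lambda>n. \<bar>a_n n - a_approx n\<bar> / (real n powr (-1/2) * 2 ^ n)) \<in> O(\<lambda>n. 1 / real n)"
proof (rule bigoI[where c = 2])
  show "\<forall>\<^sub>F n in at_top. norm (\<bar>a_n n - a_approx n\<bar> / (real n powr (-1/2) * 2 ^ n)) \<le> 2 * norm (1 / real n)"
    using eventually_gt_at_top[of 0]
  proof eventually_elim
    case (elim n)
    let ?d = "real n powr (-1/2) * 2 ^ n"
    have d: "?d > 0" using elim by simp
    have "\<bar>a_n n - a_approx n\<bar> \<le> 2 / real n * a_approx n"
      using a_n_le[OF elim] a_n_ge[OF elim] by (simp add: left_diff_distrib)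
    also have "\<dots> = 2 / real n * (sqrt (2 / pi) * ?d)" by (simp add: a_approx_def)
    \<comment> \<open>Since \<open>pi \<ge> 2\<close>, the factor \<open>sqrt (2 / pi)\<close> is at
      most 1.\<close>
    also have "\<dots> \<le> 2 / real n * (1 * ?d)"
      using pi_ge_two d by (intro mult_left_mono mult_right_mono) auto
    finally show ?case using d elim by (simp add: divide_le_eq)
  qed
qed

section \<open>Differences of \<open>half_ballot\<close> measured against \<open>a_n\<close>\<close>

lemma half_ballot_0_le:
  assumes "n > 0"
  shows "\<bar>half_ballot n 0\<bar> \<le> 4 * a_n n / real n"
proof -
  define h where "h = Suc n div 2"
  have h: "h \<le> n" "n \<le> 2 * h" "2 * h \<le> Suc n" using assms unfolding h_def by presburger+
  let ?x = "real (n choose h)"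
  let ?y = "real (n choose Suc h)"
  have "Suc h * (n choose Suc h) = (n - h) * (n choose h)"
    by (metis binomial_absorption binomial_absorb_comp)
  then have "real (Suc h) * ?y = (real n - real h) * ?x"
    using h(1) by (metis of_nat_mult of_nat_diff)
  \<comment> \<open>Since \<open>h\<close> is \<open>n / 2\<close> rounded up, the factor
    \<open>2 * h + 1 - n\<close> is 1 or 2, and division by \<open>Suc h\<close> gains the order
    \<open>1 / n\<close>.\<close>
  then have eq: "real (Suc h) * (?x - ?y) = (2 * real h + 1 - real n) * ?x"
    by (simp add: algebra_simps)
  have "real (Suc h) * (?x - ?y) \<ge> 0"
    unfolding eq using h by (intro mult_nonneg_nonneg) auto
  then have nonneg: "?x - ?y \<ge> 0" by (simp add: zero_le_mult_iff)
  have "real n * (?x - ?y) \<le> 2 * real (Suc h) * (?x - ?y)"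
    using h by (intro mult_right_mono nonneg) auto
  also have "\<dots> = 2 * ((2 * real h + 1 - real n) * ?x)" by (simp only: mult.assoc eq)
  also have "\<dots> \<le> 2 * (2 * ?x)"
    using h by (intro mult_left_mono mult_right_mono) auto
  finally have "?x - ?y \<le> 4 * ?x / real n"
    using assms by (simp add: field_simps)
  then show ?thesis using nonneg by (simp add: half_ballot_eq a_n_eq h_def)
qed

text \<open>This turns the bound for third differences into a multiple of \<open>a_n n / n\<close>;
  it follows from the lower Wallis bound and \<open>pi < 4\<close>.\<close>

lemma a_n_ge_sqrt:
  assumes "n > 0"
  shows "2 ^ n / sqrt (real (Suc n)) \<le> 2 * a_n n"
proof -
  have "1 / (4 * real (Suc n)) \<le> 2 / (pi * (real n + 2))"
  proof -
    have "pi * (real n + 2) \<le> 4 * (2 * real (Suc n))"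
      using pi_less_4 by (intro mult_mono) auto
    then have "2 / (4 * (2 * real (Suc n))) \<le> 2 / (pi * (real n + 2))"
      by (intro divide_left_mono) auto
    moreover have "2 / (4 * (2 * x)) = 1 / (4 * x)" for x :: real by simp
    ultimately show ?thesis by (simp only:)
  qed
  then have "sqrt (1 / (4 * real (Suc n))) \<le> sqrt (2 / (pi * (real n + 2)))"
    by (rule real_sqrt_le_mono)
  also have "sqrt (1 / (4 * real (Suc n))) = 1 / (2 * sqrt (real (Suc n)))"
    by (simp only: real_sqrt_divide real_sqrt_mult real_sqrt_four real_sqrt_one)
  finally have "2 ^ n * (1 / (2 * sqrt (real (Suc n)))) \<le> 2 ^ n * sqrt (2 / (pi * (real n + 2)))"
    by (rule mult_left_mono) simp
  also have "\<dots> \<le> a_n n"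
    unfolding a_n_eq by (rule middle_binomial_ge[OF assms])
  finally show ?thesis by (simp add: field_simps)
qed

text \<open>\<open>half_ballot\<close> is a first difference of binomials up to sign, so its second
  differences are third differences of the row from \<open>Suc n div 2\<close> on; the sum only
  grows when the earlier part is included.\<close>

lemma half_ballot_second_difference_le:
  assumes "n > 0"
  shows "(\<Sum>j<N. \<bar>half_ballot n j - 2 * half_ballot n (Suc j) + half_ballot n (Suc (Suc j))\<bar>)
           \<le> 96 * a_n n / real n"
proof -
  let ?h = "Suc n div 2"
  let ?D = "\<lambda>i. \<bar>real (n choose Suc (Suc (Suc i))) - 3 * real (n choose Suc (Suc i))
       + 3 * real (n choose Suc i) - real (n choose i)\<bar>"
  have "(\<Sum>j<N. \<bar>half_ballot n j - 2 * half_ballot n (Suc j) + half_ballot n (Suc (Suc j))\<bar>)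
      = (\<Sum>j<N. ?D (?h + j))"
  proof (intro sum.cong refl)
    fix j
    let ?i = "?h + j"
    have "half_ballot n j - 2 * half_ballot n (Suc j) + half_ballot n (Suc (Suc j)) =
        - (real (n choose Suc (Suc (Suc ?i))) - 3 * real (n choose Suc (Suc ?i))
           + 3 * real (n choose Suc ?i) - real (n choose ?i))"
      by (simp add: half_ballot_eq)
    then show "\<bar>half_ballot n j - 2 * half_ballot n (Suc j) + half_ballot n (Suc (Suc j))\<bar> = ?D ?i"
      by (simp only: abs_minus_cancel)
  qed
  also have "\<dots> = (\<Sum>i\<in>(+) ?h ` {..<N}. ?D i)"
    by (subst sum.reindex) (auto simp: inj_on_def)
  also have "\<dots> \<le> (\<Sum>i<?h + N. ?D i)"
    by (rule sum_mono2) auto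
  also have "\<dots> \<le> 48 * 2 ^ n / (real (Suc n) * sqrt (real (Suc n)))"
    by (rule sum_binomial_third_difference_le)
  also have "\<dots> = 48 * (2 ^ n / sqrt (real (Suc n))) / real (Suc n)"
    by simp
  also have "\<dots> \<le> 48 * (2 * a_n n) / real n"
    using assms a_n_ge_sqrt[OF assms] a_n_pos[of n] by (intro frac_le mult_left_mono) auto
  finally show ?thesis by simp
qed

section \<open>Endpoint sums over residue classes\<close>

lemma sum_residue_class:
  fixes f :: "nat \<Rightarrow> real"
  assumes "s < k"
  shows "(\<Sum>j<k * N. if j mod k = s then f j else 0) = (\<Sum>i<N. f (s + k * i))"
proof -
  have "(\<Sum>j<k * N. if j mod k = s then f j else 0) =
      (\<Sum>t<k. \<Sum>i<N. if (t + k * i) mod k = s then f (t + k * i) else 0)"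
    by (rule sum_residue_classes[symmetric])
  also have "\<dots> = (\<Sum>t<k. if t = s then (\<Sum>i<N. f (s + k * i)) else 0)"
    by (intro sum.cong refl) auto
  also have "\<dots> = (\<Sum>i<N. f (s + k * i))" using assms by simp
  finally show ?thesis .
qed

lemma half_ballot_equidistribution:
  assumes n: "n > 0" and s: "s < k"
  shows "\<bar>(\<Sum>j<Suc n. if j mod k = s then half_ballot n j else 0) - a_n n / real k\<bar>
           \<le> real k * (4 + 96 * real k) * a_n n / real n"
proof -
  \<comment> \<open>The range is extended by zero terms to a whole number of periods.\<close>
  have "(\<Sum>j<Suc n. if j mod k = s then half_ballot n j else 0) =
      (\<Sum>j<k * Suc n. if j mod k = s then half_ballot n j else 0)"
  proof (rule sum.mono_neutral_left)
    have "1 * Suc n \<le> k * Suc n" using s by (intro mult_le_mono1) simp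
    then show "{..<Suc n} \<subseteq> {..<k * Suc n}" by auto
  qed (auto simp: half_ballot_eq_0)
  also have "\<dots> = (\<Sum>i<Suc n. half_ballot n (s + k * i))"
    by (rule sum_residue_class[OF s])
  also have "\<bar>\<dots> - a_n n / real k\<bar> \<le> real k * (\<bar>half_ballot n 0\<bar> + real k * (96 * a_n n / real n))"
    unfolding a_n_eq_sum[of n]
    by (rule equidistribution_residue_classes[OF _ s])
       (use half_ballot_second_difference_le[OF n] in \<open>auto simp: half_ballot_eq_0 a_n_eq_sum[symmetric] simp del: sum.lessThan_Suc\<close>)
  also have "\<dots> \<le> real k * (4 * a_n n / real n + real k * (96 * a_n n / real n))"
    by (intro mult_left_mono add_right_mono half_ballot_0_le n) auto
  also have "\<dots> = real k * (4 + 96 * real k) * a_n n / real n"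
    by (simp add: add_divide_distrib algebra_simps)
  finally show ?thesis .
qed

text \<open>Both parities of \<open>l\<close> are treated at once: \<open>k\<close> is
  \<open>l\<close> or \<open>l / 2\<close>, and \<open>Q\<close> selects the \<open>n\<close> whose
  endpoints meet the class of \<open>r\<close>.\<close>

lemma c_n_relative_error:
  assumes "k > 0"
    and residue: "\<And>n. Q n \<Longrightarrow> \<exists>s<k. \<forall>j. (n mod 2 + 2 * j) mod l = r \<longleftrightarrow> j mod k = s"
  shows "\<exists>e. e \<in> O(\<lambda>n. 1 / real n) \<and>
           (\<forall>n. Q n \<longrightarrow> c_n l r n = (1 / real k) * a_n n * (1 + e n))"
proof (intro exI conjI allI impI)
  \<comment> \<open>The error is solved from the required equation; the value 0 where
    \<open>Q\<close> fails keeps the big-O bound valid for every large \<open>n\<close>.\<close>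
  let ?e = "\<lambda>n. if Q n then real k * c_n l r n / a_n n - 1 else 0"
  show "c_n l r n = (1 / real k) * a_n n * (1 + ?e n)" if "Q n" for n
    using that a_n_pos[of n] assms(1) by simp
  show "?e \<in> O(\<lambda>n. 1 / real n)"
  proof (rule bigoI[where c = "real k * (real k * (4 + 96 * real k))"])
    show "\<forall>\<^sub>F n in at_top. norm (?e n) \<le> real k * (real k * (4 + 96 * real k)) * norm (1 / real n)"
      using eventually_gt_at_top[of 0]
    proof eventually_elim
      case (elim n)
      show ?case
      proof (cases "Q n")
        case True
        then obtain s where s: "s < k" "\<And>j. (n mod 2 + 2 * j) mod l = r \<longleftrightarrow> j mod k = s"
          using residue by blast
        have c: "c_n l r n = (\<Sum>j<Suc n. if j mod k = s then half_ballot n j else 0)"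
          unfolding c_n_def infsum_a_nm s(2) ..
        have "?e n = real k / a_n n * (c_n l r n - a_n n / real k)"
          using True a_n_pos[of n] assms(1) by (simp add: field_simps)
        then have "norm (?e n) = real k / a_n n * \<bar>c_n l r n - a_n n / real k\<bar>"
          using a_n_pos[of n] by (simp only: real_norm_def abs_mult) simp
        also have "\<dots> \<le> real k / a_n n * (real k * (4 + 96 * real k) * a_n n / real n)"
          unfolding c using a_n_pos[of n]
          by (intro mult_left_mono half_ballot_equidistribution elim s) auto
        also have "\<dots> = real k * (real k * (4 + 96 * real k)) * norm (1 / real n)"
          using a_n_pos[of n] by simp
        finally show ?thesis .
      qed simp
    qed
  qed
qed

text \<open>Modulo \<open>l = 2 * t + 1\<close> the inverse of 2 is \<open>t + 1\<close>, so
  \<open>s\<close> is \<open>t + 1\<close> times \<open>r - p\<close>.\<close>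

lemma odd_modulus_residue_class:
  fixes l r p :: nat
  assumes "odd l" "r < l" "p < 2"
  shows "\<exists>s<l. \<forall>j. (p + 2 * j) mod l = r \<longleftrightarrow> j mod l = s"
proof -
  obtain t where l: "l = 2 * t + 1" using assms(1) by (elim oddE)
  \<comment> \<open>\<open>d\<close> represents \<open>-p\<close> modulo \<open>l\<close> within the
    natural numbers.\<close>
  define d where "d = 2 * l - p"
  have d: "p + d = 2 * l" using assms(3) l by (simp add: d_def)
  define s where "s = (t + 1) * (r + d) mod l"
  have "p + 2 * ((t + 1) * (r + d)) = r + (p + d) + l * (r + d)"
    unfolding l by (simp add: algebra_simps)
  also have "\<dots> = r + l * (2 + r + d)"
    unfolding d by (simp add: algebra_simps)
  finally have "(p + 2 * ((t + 1) * (r + d))) mod l = r"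
    using assms(2) by (simp only: mod_mult_self2 mod_less)
  moreover have red: "(p + 2 * (x mod l)) mod l = (p + 2 * x) mod l" for x
    by (metis mod_add_right_eq mod_mult_right_eq)
  ultimately have s: "(p + 2 * s) mod l = r"
    unfolding s_def by (simp only:)
  have "(p + 2 * j) mod l = r \<longleftrightarrow> j mod l = s" for j
  proof
    assume r: "(p + 2 * j) mod l = r"
    have "s = (t + 1) * ((p + 2 * j) + d) mod l"
      unfolding s_def r[symmetric] by (metis mod_add_left_eq mod_mult_right_eq)
    also have "(t + 1) * ((p + 2 * j) + d) = (t + 1) * (2 * j + (p + d))"
      by (simp only: add_ac)
    also have "\<dots> = j + l * (j + 2 * (t + 1))"
      unfolding d l by (simp add: algebra_simps)
    finally show "j mod l = s" by (simp only: mod_mult_self2)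
  next
    assume "j mod l = s"
    then show "(p + 2 * j) mod l = r" using s red[of j] by simp
  qed
  moreover have "s < l" using assms(2) by (simp add: s_def)
  ultimately show ?thesis by blast
qed

text \<open>The last binary digit \<open>p\<close> splits off, leaving \<open>j\<close> modulo
  \<open>k\<close> to be compared with \<open>r div 2\<close>.\<close>

lemma even_modulus_residue_class:
  fixes k r p :: nat
  assumes "r < 2 * k" "r mod 2 = p"
  shows "\<exists>s<k. \<forall>j. (p + 2 * j) mod (2 * k) = r \<longleftrightarrow> j mod k = s"
proof (intro exI conjI allI)
  show "r div 2 < k" using assms(1) by auto
  fix j
  have "p < 2" using assms(2) by auto
  then have "(p + 2 * j) mod (2 * k) = 2 * (j mod k) + p"
    unfolding mod_mult2_eq by simp
  moreover have "2 * x + p = r \<longleftrightarrow> x = r div 2" for x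
    unfolding assms(2)[symmetric] by presburger
  ultimately show "(p + 2 * j) mod (2 * k) = r \<longleftrightarrow> j mod k = r div 2"
    by (simp only:)
qed

text \<open>An even modulus preserves parity, so each \<open>m\<close> in the class has the wrong
  parity to be reached.\<close>

lemma c_n_eq_0:
  assumes "even l" "r mod 2 \<noteq> n mod 2"
  shows "c_n l r n = 0"
proof -
  have "a_nm n m = 0" if "m mod l = r" for m
  proof (rule a_nm_eq_0)
    have "m mod 2 = r mod 2" using that assms(1) mod_mod_cancel by metis
    then show "odd (n + m) \<or> n < m" using assms(2) by presburger
  qed
  then show ?thesis unfolding c_n_def by (intro infsum_0) auto
qed

theorem theorem2p7:
  shows "((a_n \<sim>[at_top] a_approx) \<and>
    (\<lambda>n. \<bar>a_n n - a_approx n\<bar> / (real n powr (-1/2) * 2 ^ n)) \<in> O(\<lambda>n. 1 / real n)) \<and>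
   (\<forall>l r. l \<ge> 3 \<and> r < l \<longrightarrow>
     (odd l \<longrightarrow>
       (\<exists>e. e \<in> O(\<lambda>n. 1 / real n) \<and>
          (\<forall>n. c_n l r n = (1 / real l) * a_n n * (1 + e n)))) \<and>
     (even l \<longrightarrow> (\<forall>n. r mod 2 \<noteq> n mod 2 \<longrightarrow> c_n l r n = 0)) \<and>
     (even l \<longrightarrow>
       (\<exists>e. e \<in> O(\<lambda>n. 1 / real n) \<and>
          (\<forall>n. r mod 2 = n mod 2 \<longrightarrow> c_n l r n = (2 / real l) * a_n n * (1 + e n)))))"
proof -
  have odd: "\<exists>e. e \<in> O(\<lambda>n. 1 / real n) \<and> (\<forall>n. c_n l r n = (1 / real l) * a_n n * (1 + e n))"
    if "odd l" "r < l" for l r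
  proof -
    have "l > 0" using that by simp
    then show ?thesis
      using c_n_relative_error[of l "\<lambda>_. True" l r] odd_modulus_residue_class[OF that] by simp
  qed
  have even: "\<exists>e. e \<in> O(\<lambda>n. 1 / real n) \<and>
      (\<forall>n. r mod 2 = n mod 2 \<longrightarrow> c_n l r n = (2 / real l) * a_n n * (1 + e n))"
    if "even l" "r < l" for l r
  proof -
    obtain k where l: "l = 2 * k" using \<open>even l\<close> by (elim evenE)
    have k: "k > 0" using that(2) l by simp
    \<comment> \<open>Only \<open>k = l / 2\<close> of the residues have the parity of
      \<open>n\<close>, hence the numerator 2.\<close>
    have coef: "2 / real l = 1 / real k" by (simp add: l)
    show ?thesis
      unfolding coef
      by (rule c_n_relative_error[OF k])
         (use that(2) even_modulus_residue_class in \<open>auto simp: l\<close>)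
  qed
  show ?thesis
    by (intro conjI allI impI a_n_asymp_equiv a_n_error) (elim conjE, rule odd even c_n_eq_0; assumption)+
qed

end
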